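(* Let $u\in\mathbb{S}^{2}$ be a unit vector, let $\alpha\in\mathbb{R}$, and let $R\in\mathbb{SO}(3)$ be the rotation matrix with rotation angle $\alpha$ about the axis $u$, i.e. $R=\mathbf{I}_{3}+\sin(\alpha)[u]_{\times}+(1-\cos(\alpha))[u]_{\times}^{2}$. Then $$\mathbf{vex}\left(\boldsymbol{\mathcal{P}}_{a}(R)\right)=2\cos\left(\tfrac{\alpha}{2}\right)\sin\left(\tfrac{\alpha}{2}\right)u,$$ $$\left\Vert R\right\Vert_{I}=\tfrac{1}{2}\left(1-\cos(\alpha)\right)=\sin^{2}\left(\tfrac{\alpha}{2}\right),$$ $$\left\Vert \mathbf{vex}\left(\boldsymbol{\mathcal{P}}_{a}(R)\right)\right\Vert^{2}=4\cos^{2}\left(\tfrac{\alpha}{2}\right)\sin^{2}\left(\tfrac{\alpha}{2}\right).$$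
   Context: $\mathbb{SO}(3)=\{R\in\mathbb{R}^{3\times3}: R^{\top}R=RR^{\top}=\mathbf{I}_{3},\ \det(R)=+1\}$ and $\mathbb{S}^{2}=\{x\in\mathbb{R}^{3}:\Vert x\Vert=1\}$, where $\Vert\cdot\Vert$ is the Euclidean norm on vectors. For $x=[x_1,x_2,x_3]^{\top}\in\mathbb{R}^{3}$, $[x]_{\times}=\begin{bmatrix} 0 & -x_3 & x_2 \\ x_3 & 0 & -x_1 \\ -x_2 & x_1 & 0 \end{bmatrix}$, so $[x]_{\times} y=x\times y$. The map $\mathbf{vex}$ from $3\times3$ skew-symmetric matrices to $\mathbb{R}^{3}$ is the inverse of $[\cdot]_{\times}$, i.e. $\mathbf{vex}([x]_{\times})=x$. For $B\in\mathbb{R}^{3\times3}$, $\boldsymbol{\mathcal{P}}_{a}(B)=\frac{1}{2}(B-B^{\top})$. For $R\in\mathbb{SO}(3)$ the normalized Euclidean distance is $\Vert R\Vert_{I}=\frac{1}{4}\mathrm{Tr}\{\mathbf{I}_{3}-R\}$. *)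

theory Defs
  imports "HOL-Analysis.Analysis"
begin

definition SO3 :: "(real^3^3) set" where
  "SO3 = {R. rotation_matrix R}"

definition cross_mat :: "real^3 \<Rightarrow> real^3^3" where
  "cross_mat x = vector [vector [0, - x$3, x$2],
                         vector [x$3, 0, - x$1],
                         vector [- x$2, x$1, 0]]"

text \<open>The inverse of \<open>cross_mat\<close> on its range, the skew-symmetric matrices;
  the value is unspecified on all other matrices.\<close>

definition vex :: "real^3^3 \<Rightarrow> real^3" where
  "vex = inv cross_mat"

definition antisym_proj :: "real^3^3 \<Rightarrow> real^3^3" where
  "antisym_proj B = (1/2) *\<^sub>R (B - transpose B)"

definition norm_dist :: "real^3^3 \<Rightarrow> real" where
  "norm_dist R = 1/4 * trace (mat 1 - R)"

lemma SO3_iff: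
  "R \<in> SO3 \<longleftrightarrow> transpose R ** R = mat 1 \<and> R ** transpose R = mat 1 \<and> det R = 1"
  by (simp add: SO3_def rotation_matrix_def orthogonal_matrix_def)

lemma cross_mat_mult_vec: "cross_mat x *v y = cross3 x y"
  by (simp add: cross_mat_def cross3_def matrix_vector_mult_def vec_eq_iff forall_3 sum_3)

lemma inj_cross_mat: "inj cross_mat"
  by (rule injI) (simp add: cross_mat_def vec_eq_iff forall_3)

lemma range_cross_mat: "range cross_mat = {A. transpose A = - A}"
proof (intro equalityI subsetI)
  fix A assume "A \<in> range cross_mat"
  then show "A \<in> {A. transpose A = - A}"
    by (auto simp: cross_mat_def transpose_def vec_eq_iff forall_3)
next
  fix A :: "real^3^3" assume "A \<in> {A. transpose A = - A}"
  then have T: "transpose A = - A" by blast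
  have s: "A$i$j = - (A$j$i)" for i j
    using arg_cong[OF T, of "\<lambda>B. B$j$i"] unfolding transpose_def by simp
  have "A = cross_mat (vector [A$3$2, A$1$3, A$2$1])"
    using s[of 1 1] s[of 2 2] s[of 3 3] s[of 1 2] s[of 2 3] s[of 3 1]
    by (simp add: cross_mat_def vec_eq_iff forall_3)
  then show "A \<in> range cross_mat"
    by blast
qed

lemma vex_cross_mat: "vex (cross_mat x) = x"
  by (simp add: vex_def inj_cross_mat)

text \<open>Any unit axis and any angle do give an element of \<open>SO3\<close>.\<close>

lemma angle_axis_in_SO3:
  assumes "u \<in> sphere 0 1"
  shows "mat 1 + sin \<alpha> *\<^sub>R cross_mat u
           + (1 - cos \<alpha>) *\<^sub>R (cross_mat u ** cross_mat u) \<in> SO3" (is "?R \<in> SO3")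
proof -
  define a b c s k where abc: "a = u$1" "b = u$2" "c = u$3" "s = sin \<alpha>" "k = 1 - cos \<alpha>"
  have n: "a\<^sup>2 = 1 - b\<^sup>2 - c\<^sup>2"
    using assms by (simp add: abc norm_eq_1 inner_vec_def sum_3 power2_eq_square)
  have t: "s\<^sup>2 = 2 * k - k\<^sup>2"
    using sin_cos_squared_add[of \<alpha>] by (simp add: abc power2_eq_square algebra_simps)
  have R: "?R = vector [
      vector [1 - k*(b*b+c*c), k*(a*b) - s*c, k*(a*c) + s*b],
      vector [k*(a*b) + s*c, 1 - k*(a*a+c*c), k*(b*c) - s*a],
      vector [k*(a*c) - s*b, k*(b*c) + s*a, 1 - k*(a*a+b*b)]]"
    by (simp add: abc cross_mat_def matrix_matrix_mult_def mat_def vec_eq_iff forall_3 sum_3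
        algebra_simps)
  have "transpose ?R ** ?R = mat 1"
    unfolding R
    apply (simp add: matrix_matrix_mult_def transpose_def mat_def vec_eq_iff forall_3 sum_3)
    using n t apply (intro conjI; algebra)
    done
  moreover have "det ?R = 1"
  proof -
    have "det ?R = (1 - k * (a\<^sup>2 + b\<^sup>2 + c\<^sup>2))\<^sup>2 + s\<^sup>2 * (a\<^sup>2 + b\<^sup>2 + c\<^sup>2)"
      unfolding R det_3 by (simp add: power2_eq_square algebra_simps)
    also have "\<dots> = (1 - k)\<^sup>2 + s\<^sup>2"
      using n by simp
    also have "\<dots> = 1"
      using t by (simp add: power2_eq_square algebra_simps)
    finally show ?thesis .
  qed
  ultimately show ?thesis
    by (simp add: SO3_def rotation_matrix_def orthogonal_matrix)
qed

end

theory Submission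
  imports Defs
begin

text \<open>The angle-axis formula splits \<open>R\<close> by symmetry. The identity and the square
  of \<open>cross_mat u\<close> are symmetric, so only the sine term survives
  \<open>antisym_proj\<close>, and \<open>vex\<close> reads off
  \<open>sin \<alpha> *\<^sub>R u\<close>. The trace, in turn, ignores the skew term and sees only
  the square (\<open>norm_dist_angle_axis\<close>). Half-angle identities and
  \<open>norm u = 1\<close> then give all the stated forms.\<close>

lemma antisym_proj_angle_axis:
  "antisym_proj (mat 1 + s *\<^sub>R cross_mat u + k *\<^sub>R (cross_mat u ** cross_mat u))
    = cross_mat (s *\<^sub>R u)"
  by (simp add: antisym_proj_def cross_mat_def matrix_matrix_mult_def transpose_def mat_def
      vec_eq_iff forall_3 sum_3)

text \<open>The diagonal of \<open>cross_mat u\<close> vanishes and its square, \<open>u\<close>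
  times its transpose minus \<open>(norm u)\<^sup>2\<close> times the identity, has trace
  \<open>- 2 * (norm u)\<^sup>2\<close>; the factor 1/4 leaves \<open>k / 2\<close>.\<close>

lemma norm_dist_angle_axis:
  "norm_dist (mat 1 + s *\<^sub>R cross_mat u + k *\<^sub>R (cross_mat u ** cross_mat u))
    = k / 2 * (norm u)\<^sup>2"
  unfolding power2_norm_eq_inner
  by (simp add: norm_dist_def cross_mat_def matrix_matrix_mult_def trace_def mat_def sum_3
      inner_vec_def field_simps)

theorem lemma1:
  fixes u :: "real^3" and \<alpha> :: real and R :: "real^3^3"
  assumes "u \<in> sphere 0 1"
    and "R \<in> SO3"
    and "R = mat 1 + sin \<alpha> *\<^sub>R cross_mat u
               + (1 - cos \<alpha>) *\<^sub>R (cross_mat u ** cross_mat u)"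
  shows "vex (antisym_proj R) = (2 * cos (\<alpha> / 2) * sin (\<alpha> / 2)) *\<^sub>R u
    \<and> norm_dist R = 1/2 * (1 - cos \<alpha>)
    \<and> 1/2 * (1 - cos \<alpha>) = (sin (\<alpha> / 2))\<^sup>2
    \<and> (norm (vex (antisym_proj R)))\<^sup>2 = 4 * (cos (\<alpha> / 2))\<^sup>2 * (sin (\<alpha> / 2))\<^sup>2"
proof -
  have u: "norm u = 1"
    using assms(1) by simp
  have half: "sin \<alpha> = 2 * cos (\<alpha> / 2) * sin (\<alpha> / 2)"
    using sin_double[of "\<alpha> / 2"] by simp
  have vex: "vex (antisym_proj R) = (2 * cos (\<alpha> / 2) * sin (\<alpha> / 2)) *\<^sub>R u"
    \<comment> \<open>The skew part is already \<open>cross_mat\<close> of a vector, so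
      \<open>vex\<close> cancels it by injectivity.\<close>
    unfolding assms(3) antisym_proj_angle_axis vex_cross_mat half ..
  moreover have "norm_dist R = 1/2 * (1 - cos \<alpha>)"
    unfolding assms(3) norm_dist_angle_axis by (simp add: u)
  moreover have "1/2 * (1 - cos \<alpha>) = (sin (\<alpha> / 2))\<^sup>2"
    using cos_double_sin[of "\<alpha> / 2"] by simp
  moreover have "(norm (vex (antisym_proj R)))\<^sup>2 = 4 * (cos (\<alpha> / 2))\<^sup>2 * (sin (\<alpha> / 2))\<^sup>2"
    by (simp add: vex u power_mult_distrib)
  ultimately show ?thesis
    by blast
qed

end
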